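(* Let $\Gamma$ be a one-connected graph with two components at the cut vertex $v$, and let $\Gamma_1,\Gamma_2,\tilde\Gamma_1,\tilde\Gamma_2$ be the associated subgraphs (as defined in the context). Then $$\beta_2(\overline D_2(\Gamma))=\beta_2(\overline D_2(\Gamma_1))+\beta_2(\overline D_2(\Gamma_2))+2\left(\beta_1(\tilde\Gamma_1)\beta_1(\Gamma_2)+\beta_1(\Gamma_1)\beta_1(\tilde\Gamma_2)-\beta_1(\tilde\Gamma_1)\beta_1(\tilde\Gamma_2)\right).$$
   Context: A graph is a finite one-dimensional CW-complex. For a graph $G$, $\overline D_2(G)$ (discrete configuration space of two distinguishable particles) is the cubical complex whose $k$-cells ($k=0,1,2$) are the ordered pairs $(\sigma_1,\sigma_2)$ of disjoint closed cells of $G$ (vertices or closed edges), exactly $k$ of which are edges; it is a subcomplex of $G\times G$. Here $\beta_p$ denotes the rank of the $p$-th homology group with integer coefficients. All graphs are assumed sufficiently subdivided for two particles, i.e. without loops or multiple edges (each path between distinct vertices of degree $\ne 2$ has at least one edge, each nontrivial loop has at least three edges). A one-connected graph with two components is a connected graph $\Gamma$ with a vertex $v$ such that removing $v$ together with the adjacent open edges leaves exactly two connected components; equivalently $\Gamma$ is a wedge sum of two connected graphs $\Gamma_1,\Gamma_2$ glued at $v$, regarded as subgraphs of $\Gamma$ with $\Gamma_1\cup\Gamma_2=\Gamma$ and $\Gamma_1\cap\Gamma_2=\{v\}$, each being the closure of one of the two components. Every edge incident to $v$ is subdivided one extra time (this subdivision is used throughout for $\Gamma$, $\Gamma_1$,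 $\Gamma_2$), and $\tilde\Gamma_i$ is the subgraph of $\Gamma_i$ obtained by deleting $v$ and the open edges incident to $v$. *)

theory Defs
  imports "Graph_Theory.Graph_Theory" "HOL-Algebra.Algebra"
begin

section \<open>Graphs\<close>

text \<open>
  A finite one-dimensional CW complex is a finite \<^typ>\<open>('a, 'b) pre_digraph\<close>: vertices are the
  0-cells, arcs the 1-cells, and tail and head record the attaching map of a 1-cell together with
  the orientation coming from its parametrisation.  The orientation is arbitrary and only enters
  through signs in boundary maps.  So ``no multiple edges'' must also exclude arcs joining the
  same two vertices in opposite directions, which \<^locale>\<open>nomulti_digraph\<close> does not.
\<close>

definition simple_graph :: "('a, 'b) pre_digraph \<Rightarrow> bool" where
  "simple_graph G \<longleftrightarrow> fin_digraph G \<and> loopfree_digraph G \<and>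
     inj_on (\<lambda>e. {tail G e, head G e}) (arcs G)"

text \<open>Vertex sets of the connected components, ignoring orientations.\<close>

definition component_verts :: "('a, 'b) pre_digraph \<Rightarrow> 'a set set" where
  "component_verts G = pre_digraph.sccs_verts (with_proj (mk_symmetric G))"

text \<open>
  The closure of a component \<open>C\<close> of the complement of \<open>v\<close> consists of \<open>C\<close>, \<open>v\<close> and the edges
  between them, so in a loop-free graph it is the subgraph induced by \<open>insert v C\<close>.
\<close>

definition one_connected_two ::
  "('a, 'b) pre_digraph \<Rightarrow> 'a \<Rightarrow> ('a, 'b) pre_digraph \<Rightarrow> ('a, 'b) pre_digraph \<Rightarrow> bool" where
  "one_connected_two G v G1 G2 \<longleftrightarrow>
     connected G \<and> v \<in> verts G \<and>
     (\<exists>C1 C2. C1 \<noteq> C2 \<and> component_verts (pre_digraph.del_vert G v) = {C1, C2} \<and>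
        G1 = G \<restriction> insert v C1 \<and> G2 = G \<restriction> insert v C2)"

subsection \<open>Subdividing the edges at a vertex\<close>

datatype ('a, 'b) sub_vert = Old 'a | Mid 'b

datatype 'b sub_arc = Whole 'b | FirstHalf 'b | SecondHalf 'b

definition incident_arcs :: "('a, 'b) pre_digraph \<Rightarrow> 'a \<Rightarrow> 'b set" where
  "incident_arcs G v = {e \<in> arcs G. tail G e = v \<or> head G e = v}"

primrec sub_tail :: "('a, 'b) pre_digraph \<Rightarrow> 'b sub_arc \<Rightarrow> ('a, 'b) sub_vert" where
  "sub_tail G (Whole e) = Old (tail G e)"
| "sub_tail G (FirstHalf e) = Old (tail G e)"
| "sub_tail G (SecondHalf e) = Mid e"

primrec sub_head :: "('a, 'b) pre_digraph \<Rightarrow> 'b sub_arc \<Rightarrow> ('a, 'b) sub_vert" where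
  "sub_head G (Whole e) = Old (head G e)"
| "sub_head G (FirstHalf e) = Mid e"
| "sub_head G (SecondHalf e) = Old (head G e)"

definition subdivide_at ::
  "('a, 'b) pre_digraph \<Rightarrow> 'a \<Rightarrow> (('a, 'b) sub_vert, 'b sub_arc) pre_digraph" where
  "subdivide_at G v =
     \<lparr> verts = Old ` verts G \<union> Mid ` incident_arcs G v,
       arcs = Whole ` (arcs G - incident_arcs G v)
              \<union> FirstHalf ` incident_arcs G v \<union> SecondHalf ` incident_arcs G v,
       tail = sub_tail G, head = sub_head G \<rparr>"

section \<open>Cell complexes and integral cellular homology\<close>

record 'c cell_complex =
  cells :: "'c set"
  cdim :: "'c \<Rightarrow> nat"
  bdry :: "'c \<Rightarrow> ('c \<Rightarrow>\<^sub>0 int)"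

definition cell_chain_group :: "nat \<Rightarrow> ('c, 'm) cell_complex_scheme \<Rightarrow> ('c \<Rightarrow>\<^sub>0 int) monoid" where
  "cell_chain_group p K = free_Abelian_group {\<sigma> \<in> cells K. cdim K \<sigma> = p}"

definition cell_cycles :: "nat \<Rightarrow> ('c, 'm) cell_complex_scheme \<Rightarrow> ('c \<Rightarrow>\<^sub>0 int) set" where
  "cell_cycles p K = {c \<in> carrier (cell_chain_group p K). frag_extend (bdry K) c = 0}"

definition cell_boundaries :: "nat \<Rightarrow> ('c, 'm) cell_complex_scheme \<Rightarrow> ('c \<Rightarrow>\<^sub>0 int) set" where
  "cell_boundaries p K = frag_extend (bdry K) ` carrier (cell_chain_group (Suc p) K)"

definition cell_homology_group ::
  "nat \<Rightarrow> ('c, 'm) cell_complex_scheme \<Rightarrow> ('c \<Rightarrow>\<^sub>0 int) set monoid" where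
  "cell_homology_group p K =
     subgroup_generated (cell_chain_group p K) (cell_cycles p K) Mod cell_boundaries p K"

definition int_independent :: "('a, 'm) monoid_scheme \<Rightarrow> 'a set \<Rightarrow> bool" where
  "int_independent A S \<longleftrightarrow> finite S \<and> S \<subseteq> carrier A \<and>
     (\<forall>n :: 'a \<Rightarrow> int. finprod A (\<lambda>x. x [^]\<^bsub>A\<^esub> n x) S = \<one>\<^bsub>A\<^esub> \<longrightarrow> (\<forall>x\<in>S. n x = 0))"

text \<open>
  The maximum exists for finitely generated abelian groups, in particular for the homology groups
  of finite complexes.
\<close>

definition abelian_rank :: "('a, 'm) monoid_scheme \<Rightarrow> nat" where
  "abelian_rank A = Max {card S | S. int_independent A S}"

definition betti :: "nat \<Rightarrow> ('c, 'm) cell_complex_scheme \<Rightarrow> nat" where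
  "betti p K = abelian_rank (cell_homology_group p K)"

subsection \<open>Graphs and products as cell complexes\<close>

datatype ('a, 'b) graph_cell = Vertex 'a | Edge 'b

primrec graph_cdim :: "('a, 'b) graph_cell \<Rightarrow> nat" where
  "graph_cdim (Vertex u) = 0"
| "graph_cdim (Edge e) = 1"

primrec graph_bdry ::
  "('a, 'b) pre_digraph \<Rightarrow> ('a, 'b) graph_cell \<Rightarrow> (('a, 'b) graph_cell \<Rightarrow>\<^sub>0 int)" where
  "graph_bdry G (Vertex u) = 0"
| "graph_bdry G (Edge e) = frag_of (Vertex (head G e)) - frag_of (Vertex (tail G e))"

definition graph_complex :: "('a, 'b) pre_digraph \<Rightarrow> ('a, 'b) graph_cell cell_complex" where
  "graph_complex G =
     \<lparr> cells = Vertex ` verts G \<union> Edge ` arcs G, cdim = graph_cdim, bdry = graph_bdry G \<rparr>"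

text \<open>The cellular boundary of a product cell is given by the Leibniz rule
  \<open>\<partial>(\<sigma> \<times> \<tau>) = \<partial>\<sigma> \<times> \<tau> + (-1)\<^bsup>dim \<sigma>\<^esup> \<sigma> \<times> \<partial>\<tau>\<close>.\<close>

definition prod_complex :: "'c cell_complex \<Rightarrow> 'd cell_complex \<Rightarrow> ('c \<times> 'd) cell_complex" where
  "prod_complex K L =
     \<lparr> cells = cells K \<times> cells L,
       cdim = (\<lambda>(\<sigma>, \<tau>). cdim K \<sigma> + cdim L \<tau>),
       bdry = (\<lambda>(\<sigma>, \<tau>). frag_extend (\<lambda>\<rho>. frag_of (\<rho>, \<tau>)) (bdry K \<sigma>)
                + frag_cmul ((-1) ^ cdim K \<sigma>) (frag_extend (\<lambda>\<rho>. frag_of (\<sigma>, \<rho>)) (bdry L \<tau>))) \<rparr>"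

subsection \<open>The discrete configuration space of two particles\<close>

text \<open>A closed cell, represented by the set of open cells it consists of.\<close>

primrec closed_cell ::
  "('a, 'b) pre_digraph \<Rightarrow> ('a, 'b) graph_cell \<Rightarrow> ('a, 'b) graph_cell set" where
  "closed_cell G (Vertex u) = {Vertex u}"
| "closed_cell G (Edge e) = {Edge e, Vertex (tail G e), Vertex (head G e)}"

definition disc_config2 ::
  "('a, 'b) pre_digraph \<Rightarrow> (('a, 'b) graph_cell \<times> ('a, 'b) graph_cell) cell_complex" where
  "disc_config2 G =
     (prod_complex (graph_complex G) (graph_complex G))
       \<lparr> cells := {(\<sigma>, \<tau>). \<sigma> \<in> cells (graph_complex G) \<and> \<tau> \<in> cells (graph_complex G) \<and>
                          closed_cell G \<sigma> \<inter> closed_cell G \<tau> = {}} \<rparr>"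

end

theory Submission
  imports Defs
begin

text \<open>
  Top-dimensional homology consists of cycles only, and a 2-chain of the discrete configuration
  space is an integer matrix indexed by pairs of arcs, supported on disjoint pairs; it is a cycle
  iff all its rows and columns are 1-cycles of the graph.  Since \<open>v\<close> is a cut vertex, this space of
  matrices splits into four blocks: the diagonal ones are the 2-cycles of the two parts, and an
  off-diagonal one is the kernel of
  \<open>Z\<^sub>1(\<Gamma>\<^sub>1) \<otimes> Z\<^sub>1(\<Gamma>\<^sub>2) \<rightarrow> \<int>\<^bsup>N\<^sub>1\<^esup> \<otimes> \<int>\<^bsup>N\<^sub>2\<^esup>\<close>, restriction to the stars of \<open>v\<close>.  As the
  kernel of \<open>Z\<^sub>1(\<Gamma>\<^sub>i) \<rightarrow> \<int>\<^bsup>N\<^sub>i\<^esup>\<close> is \<open>Z\<^sub>1(T\<^sub>i)\<close>, its rank is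
  \<open>b\<^sub>1 b\<^sub>2 - (b\<^sub>1 - t\<^sub>1) (b\<^sub>2 - t\<^sub>2) = t\<^sub>1 b\<^sub>2 + b\<^sub>1 t\<^sub>2 - t\<^sub>1 t\<^sub>2\<close>.

  Ranks are counted by pivots: a minimal set of coordinates on which a lattice of integer vectors is
  determined has as many elements as the rank, because minimality yields for each pivot a vector
  that is nonzero there and zero at the other pivots.
\<close>

lemma hom_finprod:
  assumes "comm_group A" "comm_group B" "h \<in> hom A B" "f \<in> S \<rightarrow> carrier A"
  shows "h (finprod A f S) = finprod B (\<lambda>x. h (f x)) S"
proof -
  interpret A: comm_group A by fact
  interpret B: comm_group B by fact
  interpret group_hom A B h
    using assms(3) by unfold_locales
  show ?thesis
    using assms(4)
  proof (induction S rule: infinite_finite_induct)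
    case (insert x F)
    then have "f \<in> F \<rightarrow> carrier A" "f x \<in> carrier A" by auto
    with insert show ?case
      by (simp add: Pi_iff)
  qed simp_all
qed

lemma int_independent_image:
  assumes "comm_group A" "comm_group B" "h \<in> hom A B" "inj_on h (carrier A)"
    and "int_independent A S"
  shows "int_independent B (h ` S)" "card (h ` S) = card S"
proof -
  interpret A: comm_group A by fact
  interpret B: comm_group B by fact
  interpret h: group_hom A B h
    using assms(3) by unfold_locales
  have S: "finite S" "S \<subseteq> carrier A"
    and ind: "\<And>n :: _ \<Rightarrow> int. finprod A (\<lambda>x. x [^]\<^bsub>A\<^esub> n x) S = \<one>\<^bsub>A\<^esub> \<Longrightarrow> \<forall>x\<in>S. n x = 0"
    using assms(5) by (auto simp: int_independent_def)
  have inj: "inj_on h S"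
    using assms(4) S(2) by (rule inj_on_subset)
  then show "card (h ` S) = card S" by (rule card_image)
  have "\<forall>y\<in>h ` S. n y = 0" if n: "finprod B (\<lambda>y. y [^]\<^bsub>B\<^esub> n y) (h ` S) = \<one>\<^bsub>B\<^esub>" for n :: "_ \<Rightarrow> int"
  proof -
    have "h (finprod A (\<lambda>x. x [^]\<^bsub>A\<^esub> n (h x)) S) = finprod B (\<lambda>x. h (x [^]\<^bsub>A\<^esub> n (h x))) S"
      using S by (intro hom_finprod assms) auto
    also have "\<dots> = finprod B (\<lambda>x. h x [^]\<^bsub>B\<^esub> n (h x)) S"
      using S by (intro B.finprod_cong') (auto simp: h.hom_int_pow)
    also have "\<dots> = finprod B (\<lambda>y. y [^]\<^bsub>B\<^esub> n y) (h ` S)"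
      using S inj by (subst B.finprod_reindex) auto
    finally have "h (finprod A (\<lambda>x. x [^]\<^bsub>A\<^esub> n (h x)) S) = h \<one>\<^bsub>A\<^esub>"
      using n by simp
    moreover have "finprod A (\<lambda>x. x [^]\<^bsub>A\<^esub> n (h x)) S \<in> carrier A"
      using S by (intro A.finprod_closed) auto
    ultimately have "finprod A (\<lambda>x. x [^]\<^bsub>A\<^esub> n (h x)) S = \<one>\<^bsub>A\<^esub>"
      using inj_onD[OF assms(4)] A.one_closed by blast
    then show ?thesis using ind[of "\<lambda>x. n (h x)"] by auto
  qed
  moreover have "h ` S \<subseteq> carrier B" using S by auto
  ultimately show "int_independent B (h ` S)"
    unfolding int_independent_def using S by auto
qed

lemma abelian_rank_iso:
  assumes "comm_group A" "comm_group B" "h \<in> iso A B"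
  shows "abelian_rank A = abelian_rank B"
proof -
  interpret A: comm_group A by fact
  interpret B: comm_group B by fact
  define g where "g = inv_into (carrier A) h"
  have g: "g \<in> iso B A"
    using A.iso_set_sym[OF assms(3)] by (simp add: g_def)
  have "(\<exists>S. int_independent A S \<and> card S = k) \<longleftrightarrow> (\<exists>S. int_independent B S \<and> card S = k)" for k
    using int_independent_image[OF assms(1,2), of h] int_independent_image[OF assms(2,1), of g] assms(3) g
    unfolding iso_def bij_betw_def by (smt (verit, ccfv_threshold) mem_Collect_eq)
  then have "{card S | S. int_independent A S} = {card S | S. int_independent B S}"
    by (auto simp: set_eq_iff) metis+
  then show ?thesis by (simp add: abelian_rank_def)
qed

section \<open>Ranks and pivots\<close>

definition determining :: "('e \<Rightarrow> int) set \<Rightarrow> 'e set \<Rightarrow> bool" where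
  "determining U P \<longleftrightarrow> (\<forall>u\<in>U. (\<forall>p\<in>P. u p = 0) \<longrightarrow> (\<forall>x. u x = 0))"

definition pivots :: "('e \<Rightarrow> int) set \<Rightarrow> 'e set \<Rightarrow> bool" where
  "pivots U P \<longleftrightarrow> finite P \<and> determining U P \<and>
     (\<forall>p\<in>P. \<exists>u\<in>U. u p \<noteq> 0 \<and> (\<forall>q\<in>P - {p}. u q = 0))"

lemma minimal_determining:
  assumes "finite E" "determining U (E \<union> Q)"
  shows "\<exists>P\<subseteq>E. determining U (P \<union> Q) \<and>
           (\<forall>p\<in>P. \<exists>u\<in>U. u p \<noteq> 0 \<and> (\<forall>q\<in>(P - {p}) \<union> Q. u q = 0))"
  using assms
proof (induction E rule: finite_psubset_induct)
  case (psubset E)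
  show ?case
  proof (cases "\<exists>p\<in>E. determining U ((E - {p}) \<union> Q)")
    case True
    then obtain p where "p \<in> E" "determining U ((E - {p}) \<union> Q)" by blast
    with psubset.IH[of "E - {p}"] show ?thesis
      by (metis Diff_subset order_trans psubsetI Diff_iff singletonI)
  next
    case False
    have "\<exists>u\<in>U. u p \<noteq> 0 \<and> (\<forall>q\<in>(E - {p}) \<union> Q. u q = 0)" if "p \<in> E" for p
    proof -
      from False that obtain u x where u: "u \<in> U" "\<forall>q\<in>(E - {p}) \<union> Q. u q = 0" "u x \<noteq> 0"
        unfolding determining_def by blast
      moreover have "u p \<noteq> 0"
      proof
        assume "u p = 0"
        with u have "\<forall>q\<in>E \<union> Q. u q = 0" by blast
        with u psubset.prems show False unfolding determining_def by blast
      qed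
      ultimately show ?thesis by blast
    qed
    with psubset.prems show ?thesis by blast
  qed
qed

lemma integer_relation:
  fixes f :: "'s \<Rightarrow> 'p \<Rightarrow> int"
  assumes "finite P" "finite S" "card P < card S"
  shows "\<exists>n :: 's \<Rightarrow> int. (\<exists>s\<in>S. n s \<noteq> 0) \<and> (\<forall>p\<in>P. (\<Sum>s\<in>S. n s * f s p) = 0)"
  using assms
proof (induction P arbitrary: S f rule: finite_induct)
  case empty
  then have "S \<noteq> {}" by auto
  then show ?case by (intro exI[of _ "\<lambda>_. 1"]) auto
next
  case (insert p P)
  show ?case
  proof (cases "\<forall>s\<in>S. f s p = 0")
    case True
    have "card P < card S" using insert by simp
    from insert.IH[OF insert.prems(1) this, of f] True show ?thesis by auto
  next
    case False
    then obtain t where t: "t \<in> S" "f t p \<noteq> 0" by blast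
    define g where "g s q = f t p * f s q - f s p * f t q" for s q
    have "card P < card (S - {t})" using insert t by simp
    from insert.IH[OF _ this, of g] insert.prems obtain m where
      m: "\<exists>s\<in>S - {t}. m s \<noteq> 0" "\<forall>q\<in>P. (\<Sum>s\<in>S - {t}. m s * g s q) = 0" by auto
    define n where "n = (\<lambda>s. m s * f t p)(t := - (\<Sum>s\<in>S - {t}. m s * f s p))"
    have "(\<Sum>s\<in>S. n s * f s q) = (\<Sum>s\<in>S - {t}. m s * g s q)" for q
    proof -
      have "(\<Sum>s\<in>S. n s * f s q) = n t * f t q + (\<Sum>s\<in>S - {t}. n s * f s q)"
        using t insert.prems by (simp add: sum.remove)
      also have "(\<Sum>s\<in>S - {t}. n s * f s q) = (\<Sum>s\<in>S - {t}. m s * f t p * f s q)"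
        by (rule sum.cong) (auto simp: n_def)
      finally show ?thesis
        by (simp add: n_def g_def right_diff_distrib sum_subtractf sum_distrib_right mult.assoc)
    qed
    moreover have "g s p = 0" for s by (simp add: g_def)
    ultimately have "\<forall>q\<in>insert p P. (\<Sum>s\<in>S. n s * f s q) = 0" using m(2) by simp
    moreover have "\<exists>s\<in>S. n s \<noteq> 0" using m(1) t by (auto simp: n_def)
    ultimately show ?thesis by blast
  qed
qed

lemma subgroup_cell_cycles: "subgroup (cell_cycles p K) (cell_chain_group p K)"
proof
  show "cell_cycles p K \<subseteq> carrier (cell_chain_group p K)"
    by (auto simp: cell_cycles_def)
  show "x \<otimes>\<^bsub>cell_chain_group p K\<^esub> y \<in> cell_cycles p K"
    if "x \<in> cell_cycles p K" "y \<in> cell_cycles p K" for x y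
    using that keys_add[of x y]
    by (auto simp: cell_cycles_def cell_chain_group_def frag_extend_add)
  show "\<one>\<^bsub>cell_chain_group p K\<^esub> \<in> cell_cycles p K"
    by (simp add: cell_cycles_def cell_chain_group_def)
  show "inv\<^bsub>cell_chain_group p K\<^esub> x \<in> cell_cycles p K" if "x \<in> cell_cycles p K" for x
    using that by (auto simp: cell_cycles_def cell_chain_group_def frag_extend_minus)
qed

definition cycle_group :: "nat \<Rightarrow> 'c cell_complex \<Rightarrow> ('c \<Rightarrow>\<^sub>0 int) monoid" where
  "cycle_group p K = subgroup_generated (cell_chain_group p K) (cell_cycles p K)"

lemma comm_group_cycle_group: "comm_group (cycle_group p K)"
  unfolding cycle_group_def cell_chain_group_def
  by (intro group.abelian_subgroup_generated group_free_Abelian_group abelian_free_Abelian_group)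

lemma cycle_group_simps [simp]:
  "carrier (cycle_group p K) = cell_cycles p K"
  "\<one>\<^bsub>cycle_group p K\<^esub> = 0"
  "x \<otimes>\<^bsub>cycle_group p K\<^esub> y = x + y"
  unfolding cycle_group_def
  using subgroup.carrier_subgroup_generated_subgroup[OF subgroup_cell_cycles]
  by (auto simp: cell_chain_group_def)

lemma int_pow_cycle_group:
  assumes "x \<in> cell_cycles p K"
  shows "x [^]\<^bsub>cycle_group p K\<^esub> (n :: int) = frag_cmul n x"
proof -
  have "x \<in> carrier (cycle_group p K)" using assms by simp
  then have "x [^]\<^bsub>cycle_group p K\<^esub> n = x [^]\<^bsub>cell_chain_group p K\<^esub> n"
    unfolding cycle_group_def cell_chain_group_def
    by (rule group.int_pow_subgroup_generated[OF group_free_Abelian_group])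
  with assms show ?thesis
    by (simp add: cell_cycles_def cell_chain_group_def)
qed

lemma finprod_cycle_group:
  assumes "f \<in> S \<rightarrow> cell_cycles p K"
  shows "finprod (cycle_group p K) f S = sum f S"
proof -
  interpret comm_group "cycle_group p K" by (rule comm_group_cycle_group)
  show ?thesis using assms
  proof (induction S rule: infinite_finite_induct)
    case (insert x F)
    then have "f \<in> F \<rightarrow> carrier (cycle_group p K)" "f x \<in> carrier (cycle_group p K)" by auto
    with insert show ?case by (simp add: Pi_iff)
  qed simp_all
qed

lemma int_independent_cycle_group:
  "int_independent (cycle_group p K) S \<longleftrightarrow> finite S \<and> S \<subseteq> cell_cycles p K \<and>
     (\<forall>n. (\<Sum>x\<in>S. frag_cmul (n x) x) = 0 \<longrightarrow> (\<forall>x\<in>S. n x = 0))"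
proof -
  interpret comm_group "cycle_group p K" by (rule comm_group_cycle_group)
  have "finprod (cycle_group p K) (\<lambda>x. x [^]\<^bsub>cycle_group p K\<^esub> n x) S = (\<Sum>x\<in>S. frag_cmul (n x) x)"
    if S: "S \<subseteq> cell_cycles p K" for n :: "_ \<Rightarrow> int"
  proof -
    have "x [^]\<^bsub>cycle_group p K\<^esub> n x \<in> carrier (cycle_group p K)" if "x \<in> S" for x
      using that S by (intro int_pow_closed) auto
    then have "finprod (cycle_group p K) (\<lambda>x. x [^]\<^bsub>cycle_group p K\<^esub> n x) S
        = (\<Sum>x\<in>S. x [^]\<^bsub>cycle_group p K\<^esub> n x)"
      by (intro finprod_cycle_group) auto
    also have "\<dots> = (\<Sum>x\<in>S. frag_cmul (n x) x)"
      using S by (intro sum.cong) (auto simp: int_pow_cycle_group)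
    finally show ?thesis .
  qed
  then show ?thesis by (auto simp: int_independent_def)
qed

lemma betti_top_dimension:
  assumes "\<And>\<sigma>. \<sigma> \<in> cells K \<Longrightarrow> cdim K \<sigma> \<le> p"
  shows "betti p K = abelian_rank (cycle_group p K)"
proof -
  interpret comm_group "cycle_group p K" by (rule comm_group_cycle_group)
  have "{\<sigma> \<in> cells K. cdim K \<sigma> = Suc p} = {}"
    using assms by force
  then have "cell_boundaries p K = {\<one>\<^bsub>cycle_group p K\<^esub>}"
    unfolding cell_boundaries_def cell_chain_group_def by (simp only:) (simp add: free_Abelian_group_def)
  then have H: "cell_homology_group p K = cycle_group p K Mod {\<one>\<^bsub>cycle_group p K\<^esub>}"
    by (simp add: cell_homology_group_def cycle_group_def)
  have "comm_group (cycle_group p K Mod {\<one>\<^bsub>cycle_group p K\<^esub>})"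
    by (rule abelian_FactGroup[OF triv_subgroup])
  moreover have "the_elem \<in> iso (cycle_group p K Mod {\<one>\<^bsub>cycle_group p K\<^esub>}) (cycle_group p K)"
    using trivial_factor_iso by simp
  ultimately have "abelian_rank (cycle_group p K Mod {\<one>\<^bsub>cycle_group p K\<^esub>}) = abelian_rank (cycle_group p K)"
    by (rule abelian_rank_iso[OF _ comm_group_cycle_group])
  then show ?thesis by (simp only: betti_def H)
qed

lemma betti_eq_card_pivots:
  fixes K :: "'c cell_complex" and j :: "'e \<Rightarrow> 'c"
  assumes top: "\<And>\<sigma>. \<sigma> \<in> cells K \<Longrightarrow> cdim K \<sigma> \<le> p"
    and range: "\<And>\<sigma>. \<sigma> \<in> cells K \<Longrightarrow> cdim K \<sigma> = p \<Longrightarrow> \<sigma> \<in> range j"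
    and U: "(\<lambda>c e. poly_mapping.lookup c (j e)) ` cell_cycles p K = U"
    and piv: "pivots U P"
  shows "betti p K = card P"
proof -
  interpret comm_group "cycle_group p K" by (rule comm_group_cycle_group)
  let ?L = "\<lambda>c e. poly_mapping.lookup c (j e)"
  have fin: "finite P" and det: "determining U P"
    and wit: "\<And>p. p \<in> P \<Longrightarrow> \<exists>u\<in>U. u p \<noteq> 0 \<and> (\<forall>q\<in>P - {p}. u q = 0)"
    using piv by (auto simp: pivots_def)
  have zero: "c = 0" if c: "c \<in> cell_cycles p K" and P: "\<forall>p\<in>P. ?L c p = 0" for c
  proof -
    have "?L c e = 0" for e
      using det c P U unfolding determining_def by blast
    moreover have "poly_mapping.lookup c \<sigma> = 0" if "\<sigma> \<notin> range j" for \<sigma>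
      using c that range by (auto simp: cell_cycles_def cell_chain_group_def in_keys_iff)
    ultimately have "poly_mapping.lookup c \<sigma> = 0" for \<sigma>
      by (cases "\<sigma> \<in> range j") auto
    then show ?thesis by (intro poly_mapping_eqI) simp
  qed
  have lookup_comb: "?L (\<Sum>x\<in>S. frag_cmul (n x) x) e = (\<Sum>x\<in>S. n x * ?L x e)" for S n e
    by (simp add: lookup_sum)
  have upper: "card S \<le> card P" if S: "int_independent (cycle_group p K) S" for S
  proof (rule ccontr)
    assume "\<not> card S \<le> card P"
    with S obtain n where n: "\<exists>s\<in>S. n s \<noteq> 0" "\<forall>p\<in>P. (\<Sum>s\<in>S. n s * ?L s p) = 0"
      using integer_relation[OF fin, of S ?L] by (auto simp: int_independent_cycle_group)
    have "frag_cmul (n x) x \<in> carrier (cycle_group p K)" if "x \<in> S" for x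
      using int_pow_closed[of x "n x"] int_pow_cycle_group[of x p K "n x"] S that
      by (auto simp: int_independent_cycle_group)
    then have "finprod (cycle_group p K) (\<lambda>x. frag_cmul (n x) x) S \<in> carrier (cycle_group p K)"
      "(\<lambda>x. frag_cmul (n x) x) \<in> S \<rightarrow> cell_cycles p K"
      by (auto intro!: finprod_closed simp del: cycle_group_simps) simp
    then have "(\<Sum>x\<in>S. frag_cmul (n x) x) \<in> cell_cycles p K"
      by (simp add: finprod_cycle_group)
    then have "(\<Sum>x\<in>S. frag_cmul (n x) x) = 0"
      using n(2) by (intro zero) (simp_all add: lookup_comb)
    with S n(1) show False by (auto simp: int_independent_cycle_group)
  qed
  have "\<exists>c\<in>cell_cycles p K. ?L c q \<noteq> 0 \<and> (\<forall>r\<in>P - {q}. ?L c r = 0)" if "q \<in> P" for q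
    using wit[OF that] unfolding U[symmetric] by blast
  then obtain w where w: "\<And>q. q \<in> P \<Longrightarrow> w q \<in> cell_cycles p K"
    "\<And>q. q \<in> P \<Longrightarrow> ?L (w q) q \<noteq> 0"
    "\<And>q r. q \<in> P \<Longrightarrow> r \<in> P \<Longrightarrow> r \<noteq> q \<Longrightarrow> ?L (w q) r = 0"
    by (metis Diff_iff singletonD)
  have inj: "inj_on w P"
    by (rule inj_onI) (metis w(2,3))
  have "int_independent (cycle_group p K) (w ` P)"
    unfolding int_independent_cycle_group
  proof (intro conjI allI impI)
    show "finite (w ` P)" "w ` P \<subseteq> cell_cycles p K" using fin w by auto
    fix n assume n: "(\<Sum>x\<in>w ` P. frag_cmul (n x) x) = 0"
    have "n (w q) = 0" if q: "q \<in> P" for q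
    proof -
      have "0 = (\<Sum>x\<in>w ` P. n x * ?L x q)"
        unfolding lookup_comb[symmetric] n by simp
      also have "\<dots> = (\<Sum>r\<in>P. n (w r) * ?L (w r) q)"
        by (simp add: sum.reindex[OF inj])
      also have "\<dots> = n (w q) * ?L (w q) q"
        using fin q by (subst sum.remove[of _ q]) (auto intro!: sum.neutral simp: w(3))
      finally show ?thesis using w(2)[OF q] by simp
    qed
    then show "\<forall>x\<in>w ` P. n x = 0" by blast
  qed
  then have "card P \<in> {card S | S. int_independent (cycle_group p K) S}"
    using card_image[OF inj] by force
  then have "Max {card S | S. int_independent (cycle_group p K) S} = card P"
    using upper by (intro Max_eqI) (auto intro: finite_subset[of _ "{..card P}"])
  then show ?thesis
    by (simp add: betti_top_dimension[OF top] abelian_rank_def)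
qed

section \<open>Cycles as integer functions on arcs\<close>

lemma lookup_frag_extend:
  assumes "finite S" "Poly_Mapping.keys c \<subseteq> S"
  shows "poly_mapping.lookup (frag_extend b c) \<tau>
       = (\<Sum>x\<in>S. poly_mapping.lookup c x * poly_mapping.lookup (b x) \<tau>)"
  unfolding frag_extend_def lookup_sum lookup_frag_cmul
  using assms by (intro sum.mono_neutral_left) (auto simp: in_keys_iff)

lemma lookup_frag_of: "poly_mapping.lookup (frag_of a) b = of_bool (a = b)"
  by (simp add: lookup_single when_def)

lemma lookup_cell_cycles:
  assumes j: "inj j" and fin: "finite E" and cells: "{\<sigma> \<in> cells K. cdim K \<sigma> = p} = j ` E"
  shows "(\<lambda>c e. poly_mapping.lookup c (j e)) ` cell_cycles p K
       = {u. (\<forall>e. e \<notin> E \<longrightarrow> u e = 0) \<and>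
             (\<forall>\<tau>. (\<Sum>e\<in>E. u e * poly_mapping.lookup (bdry K (j e)) \<tau>) = 0)}"
    (is "?L ` _ = ?R")
proof -
  have mem: "c \<in> cell_cycles p K \<longleftrightarrow> Poly_Mapping.keys c \<subseteq> j ` E \<and>
      (\<forall>\<tau>. (\<Sum>e\<in>E. ?L c e * poly_mapping.lookup (bdry K (j e)) \<tau>) = 0)" for c
  proof -
    have "poly_mapping.lookup (frag_extend (bdry K) c) \<tau>
        = (\<Sum>e\<in>E. ?L c e * poly_mapping.lookup (bdry K (j e)) \<tau>)"
      if "Poly_Mapping.keys c \<subseteq> j ` E" for \<tau>
      using lookup_frag_extend[OF finite_imageI[OF fin] that, of "bdry K" \<tau>]
      unfolding sum.reindex[OF inj_on_subset[OF j subset_UNIV]] by simp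
    moreover have "frag_extend (bdry K) c = 0
        \<longleftrightarrow> (\<forall>\<tau>. poly_mapping.lookup (frag_extend (bdry K) c) \<tau> = 0)"
      by (auto intro: poly_mapping_eqI)
    ultimately show ?thesis
      by (cases "Poly_Mapping.keys c \<subseteq> j ` E")
        (simp_all add: cell_cycles_def cell_chain_group_def cells)
  qed
  show ?thesis
  proof (intro equalityI subsetI)
    fix u assume "u \<in> ?L ` cell_cycles p K"
    then obtain c where c: "c \<in> cell_cycles p K" "u = ?L c" by blast
    have "u e = 0" if "e \<notin> E" for e
    proof -
      have "j e \<notin> Poly_Mapping.keys c"
        using c(1) that unfolding mem subset_iff inj_image_mem_iff[OF j, symmetric] by blast
      then show ?thesis by (simp add: c(2) in_keys_iff)
    qed
    then show "u \<in> ?R" using c by (simp add: mem)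
  next
    fix u assume u: "u \<in> ?R"
    define c where "c = (\<Sum>e\<in>E. frag_cmul (u e) (frag_of (j e)))"
    have "?L c = u"
    proof
      fix e
      have "?L c e = (\<Sum>e'\<in>E. if e' = e then u e' else 0)"
        unfolding c_def lookup_sum by (intro sum.cong) (auto simp: lookup_frag_of inj_eq[OF j])
      also have "\<dots> = u e" using u fin by simp
      finally show "?L c e = u e" .
    qed
    moreover have "Poly_Mapping.keys c \<subseteq> j ` E"
      unfolding c_def by (rule order_trans[OF keys_sum]) auto
    ultimately have "c \<in> cell_cycles p K" unfolding mem using u by auto
    with \<open>?L c = u\<close> show "u \<in> ?L ` cell_cycles p K" by blast
  qed
qed

definition incidence :: "('a, 'b) pre_digraph \<Rightarrow> 'a \<Rightarrow> 'b \<Rightarrow> int" where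
  "incidence G w e = of_bool (head G e = w) - of_bool (tail G e = w)"

definition ends :: "('a, 'b) pre_digraph \<Rightarrow> 'b \<Rightarrow> 'a set" where
  "ends G e = {tail G e, head G e}"

definition cycle_space :: "('a, 'b) pre_digraph \<Rightarrow> ('b \<Rightarrow> int) set" where
  "cycle_space G = {u. (\<forall>e. e \<notin> arcs G \<longrightarrow> u e = 0) \<and>
     (\<forall>w. (\<Sum>e\<in>arcs G. u e * incidence G w e) = 0)}"

definition matrix_space ::
  "('e \<Rightarrow> int) set \<Rightarrow> ('f \<Rightarrow> int) set \<Rightarrow> ('e \<times> 'f) set \<Rightarrow> ('e \<times> 'f \<Rightarrow> int) set" where
  "matrix_space U V Z = {c. (\<forall>f. (\<lambda>e. c (e, f)) \<in> U) \<and> (\<forall>e. (\<lambda>f. c (e, f)) \<in> V) \<and>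
     (\<forall>z\<in>Z. c z = 0)}"

definition meeting :: "('a, 'b) pre_digraph \<Rightarrow> ('b \<times> 'b) set" where
  "meeting G = {(e, f). ends G e \<inter> ends G f \<noteq> {}}"

lemma graph_cell_all: "(\<forall>\<tau>. P \<tau>) \<longleftrightarrow> (\<forall>w. P (Vertex w)) \<and> (\<forall>e. P (Edge e))"
  by (metis graph_cell.exhaust)

lemma betti_graph_complex:
  assumes "finite (arcs G)" "pivots (cycle_space G) P"
  shows "betti 1 (graph_complex G) = card P"
proof (rule betti_eq_card_pivots[OF _ _ refl])
  show "cdim (graph_complex G) \<sigma> \<le> 1" if "\<sigma> \<in> cells (graph_complex G)" for \<sigma>
    using that by (auto simp: graph_complex_def)
  show "\<sigma> \<in> range Edge" if "\<sigma> \<in> cells (graph_complex G)" "cdim (graph_complex G) \<sigma> = 1" for \<sigma>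
    using that by (auto simp: graph_complex_def)
  have bd: "(\<forall>\<tau>. (\<Sum>e\<in>arcs G. u e * poly_mapping.lookup (bdry (graph_complex G) (Edge e)) \<tau>) = 0)
      \<longleftrightarrow> (\<forall>w. (\<Sum>e\<in>arcs G. u e * incidence G w e) = 0)" (is "(\<forall>\<tau>. ?s \<tau> = 0) \<longleftrightarrow> _") for u
  proof -
    have "?s (Vertex w) = (\<Sum>e\<in>arcs G. u e * incidence G w e)" "?s (Edge f) = 0" for w f
      by (auto simp: graph_complex_def lookup_minus incidence_def intro!: sum.cong)
    then show ?thesis by (simp add: graph_cell_all)
  qed
  have "{\<sigma> \<in> cells (graph_complex G). cdim (graph_complex G) \<sigma> = 1} = Edge ` arcs G"
    by (auto simp: graph_complex_def)
  then have "(\<lambda>c e. poly_mapping.lookup c (Edge e)) ` cell_cycles 1 (graph_complex G) = cycle_space G"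
    unfolding cycle_space_def bd[symmetric]
    by (intro lookup_cell_cycles assms) (auto simp: inj_def)
  with assms show "pivots ((\<lambda>c e. poly_mapping.lookup c (Edge e)) ` cell_cycles 1 (graph_complex G)) P"
    by simp
qed

text \<open>The boundary of a 2-chain has its \<open>0 \<times> 1\<close> and \<open>1 \<times> 0\<close> parts on distinct cells, so both vanish
  separately: rows and columns of the coefficient matrix are cycles.\<close>

lemma betti_disc_config2:
  assumes fin: "finite (arcs G)"
    and piv: "pivots (matrix_space (cycle_space G) (cycle_space G) (meeting G)) P"
  shows "betti 2 (disc_config2 G) = card P"
proof -
  let ?K = "disc_config2 G"
  let ?j = "\<lambda>(e, f). (Edge e, Edge f)"
  let ?E = "arcs G \<times> arcs G - meeting G"
  have cells: "{\<sigma> \<in> cells ?K. cdim ?K \<sigma> = 2} = ?j ` ?E"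
    by (auto simp: disc_config2_def prod_complex_def graph_complex_def meeting_def ends_def)
  have bd: "((\<forall>z. z \<notin> ?E \<longrightarrow> u z = 0) \<and> (\<forall>\<tau>. (\<Sum>z\<in>?E. u z * poly_mapping.lookup (bdry ?K (?j z)) \<tau>) = 0))
      \<longleftrightarrow> u \<in> matrix_space (cycle_space G) (cycle_space G) (meeting G)" for u
  proof (cases "\<forall>z. z \<notin> ?E \<longrightarrow> u z = 0")
    case False
    then show ?thesis
      by (auto simp: matrix_space_def cycle_space_def)
  next
    case True
    let ?s = "\<lambda>\<tau>. \<Sum>z\<in>?E. u z * poly_mapping.lookup (bdry ?K (?j z)) \<tau>"
    have s: "?s \<tau> = (\<Sum>e\<in>arcs G. \<Sum>f\<in>arcs G. u (e, f) * poly_mapping.lookup (bdry ?K (?j (e, f))) \<tau>)" for \<tau>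
      unfolding sum.cartesian_product using fin True
      by (intro sum.mono_neutral_cong_left) auto
    have l: "poly_mapping.lookup (bdry ?K (Edge e, Edge f)) (Vertex w, Edge g) = of_bool (f = g) * incidence G w e"
      "poly_mapping.lookup (bdry ?K (Edge e, Edge f)) (Edge g, Vertex w) = - of_bool (e = g) * incidence G w f"
      "poly_mapping.lookup (bdry ?K (Edge e, Edge f)) (Vertex w, Vertex w') = 0"
      "poly_mapping.lookup (bdry ?K (Edge e, Edge f)) (Edge g, Edge g') = 0" for e f g g' w w'
      by (auto simp: disc_config2_def prod_complex_def graph_complex_def frag_extend_diff lookup_add lookup_minus
          lookup_frag_of incidence_def)
    have zero: "u (e, f) = 0" if "e \<notin> arcs G \<or> f \<notin> arcs G" for e f
      using True that by auto
    have VE: "?s (Vertex w, Edge g) = (\<Sum>e\<in>arcs G. u (e, g) * incidence G w e)" for w g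
    proof -
      have "?s (Vertex w, Edge g)
          = (\<Sum>e\<in>arcs G. \<Sum>f\<in>arcs G. if f = g then u (e, f) * incidence G w e else 0)"
        unfolding s by (intro sum.cong) (auto simp: l)
      also have "\<dots> = (\<Sum>e\<in>arcs G. u (e, g) * incidence G w e)"
        using fin zero by (intro sum.cong) auto
      finally show ?thesis .
    qed
    have EV: "?s (Edge g, Vertex w) = - (\<Sum>f\<in>arcs G. u (g, f) * incidence G w f)" for w g
    proof -
      have "?s (Edge g, Vertex w)
          = (\<Sum>f\<in>arcs G. \<Sum>e\<in>arcs G. if e = g then - (u (e, f) * incidence G w f) else 0)"
        unfolding s by (subst sum.swap, intro sum.cong) (auto simp: l)
      also have "\<dots> = (\<Sum>f\<in>arcs G. - (u (g, f) * incidence G w f))"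
        using fin zero by (intro sum.cong) auto
      finally show ?thesis by (simp add: sum_negf)
    qed
    have "?s (Vertex w, Vertex w') = 0" "?s (Edge e, Edge f) = 0" for w w' e f
      unfolding s by (simp_all add: l)
    then have "(\<forall>\<tau>. ?s \<tau> = 0) \<longleftrightarrow>
        (\<forall>w g. ?s (Vertex w, Edge g) = 0) \<and> (\<forall>w g. ?s (Edge g, Vertex w) = 0)"
      unfolding split_paired_All graph_cell_all by blast
    also have "\<dots> \<longleftrightarrow> u \<in> matrix_space (cycle_space G) (cycle_space G) (meeting G)"
      unfolding VE EV using True zero
      by (auto simp: matrix_space_def cycle_space_def)
    finally show ?thesis using True by simp
  qed
  have "(\<lambda>c e. poly_mapping.lookup c (?j e)) ` cell_cycles 2 ?K
      = matrix_space (cycle_space G) (cycle_space G) (meeting G)"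
    using lookup_cell_cycles[OF _ _ cells] fin bd by (auto simp: inj_def)
  moreover have "cdim ?K \<sigma> \<le> 2" if "\<sigma> \<in> cells ?K" for \<sigma>
    using that by (auto simp: disc_config2_def prod_complex_def graph_complex_def)
  moreover have "\<sigma> \<in> range ?j" if "\<sigma> \<in> cells ?K" "cdim ?K \<sigma> = 2" for \<sigma>
    using that cells by blast
  ultimately show ?thesis
    using piv by (intro betti_eq_card_pivots)
qed

definition cut :: "'e set \<Rightarrow> ('e \<Rightarrow> int) \<Rightarrow> 'e \<Rightarrow> int" where
  "cut S u = (\<lambda>e. if e \<in> S then u e else 0)"

lemma determiningD: "determining U P \<Longrightarrow> u \<in> U \<Longrightarrow> (\<And>p. p \<in> P \<Longrightarrow> u p = 0) \<Longrightarrow> u x = 0"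
  by (simp add: determining_def)

lemma pivots_exists:
  assumes "finite E" "\<And>u e. u \<in> U \<Longrightarrow> e \<notin> E \<Longrightarrow> u e = 0"
  shows "\<exists>P. pivots U P"
proof -
  have "determining U (E \<union> {})"
    using assms(2) by (auto simp: determining_def)
  from minimal_determining[OF assms(1) this] show ?thesis
    using assms(1) by (auto simp: pivots_def intro: finite_subset)
qed

lemma adapted_pivots:
  assumes fin: "finite E" "finite N" and supp: "\<And>u e. u \<in> U \<Longrightarrow> e \<notin> E \<Longrightarrow> u e = 0"
  shows "\<exists>P0 PN. PN \<subseteq> N \<and> P0 \<inter> PN = {} \<and> pivots {u \<in> U. \<forall>e\<in>N. u e = 0} P0 \<and> pivots U (P0 \<union> PN)"
proof -
  let ?W = "{u \<in> U. \<forall>e\<in>N. u e = 0}"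
  obtain P0 where P0: "pivots ?W P0"
    using pivots_exists[OF fin(1), of ?W] supp by auto
  have disj: "P0 \<inter> N = {}"
    using P0 by (auto simp: pivots_def)
  have "determining U (N \<union> P0)"
    using P0 by (auto simp: pivots_def determining_def)
  from minimal_determining[OF fin(2) this] obtain PN where
    PN: "PN \<subseteq> N" "determining U (PN \<union> P0)"
    "\<And>p. p \<in> PN \<Longrightarrow> \<exists>u\<in>U. u p \<noteq> 0 \<and> (\<forall>q\<in>(PN - {p}) \<union> P0. u q = 0)" by blast
  have "\<exists>u\<in>U. u p \<noteq> 0 \<and> (\<forall>q\<in>(P0 \<union> PN) - {p}. u q = 0)" if "p \<in> P0 \<union> PN" for p
  proof (cases "p \<in> PN")
    case True
    with PN(3) show ?thesis by blast
  next
    case False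
    with that P0 obtain u where "u \<in> ?W" "u p \<noteq> 0" "\<forall>q\<in>P0 - {p}. u q = 0"
      unfolding pivots_def by blast
    with PN(1) show ?thesis by blast
  qed
  moreover have "finite (P0 \<union> PN)"
    using P0 PN(1) fin(2) by (auto simp: pivots_def intro: finite_subset)
  ultimately have "pivots U (P0 \<union> PN)"
    using PN(2) by (auto simp: pivots_def Un_commute)
  with P0 PN(1) disj show ?thesis by blast
qed

lemma pivots_matrix_space:
  assumes U: "\<And>u k. u \<in> U \<Longrightarrow> (\<lambda>e. k * u e) \<in> U" and V: "\<And>v k. v \<in> V \<Longrightarrow> (\<lambda>e. k * v e) \<in> V"
    and P: "PM \<subseteq> M" "P0 \<inter> PM = {}" "pivots {u \<in> U. \<forall>e\<in>M. u e = 0} P0" "pivots U (P0 \<union> PM)"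
    and Q: "QN \<subseteq> N" "Q0 \<inter> QN = {}" "pivots {v \<in> V. \<forall>f\<in>N. v f = 0} Q0" "pivots V (Q0 \<union> QN)"
  shows "pivots (matrix_space U V (M \<times> N)) ((P0 \<union> PM) \<times> (Q0 \<union> QN) - PM \<times> QN)"
    (is "pivots ?X ?R")
  unfolding pivots_def
proof (intro conjI ballI)
  show "finite ?R" using P(4) Q(4) by (simp add: pivots_def)
  show "determining ?X ?R"
    unfolding determining_def
  proof (intro ballI impI allI)
    fix c z assume c: "c \<in> ?X" and R: "\<forall>p\<in>?R. c p = 0"
    have detU: "determining U (P0 \<union> PM)" and detV: "determining V (Q0 \<union> QN)"
      using P(4) Q(4) by (simp_all add: pivots_def)
    have PQ: "c (p, q) = 0" if "p \<in> P0 \<union> PM" "q \<in> Q0 \<union> QN" for p q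
    proof (cases "(p, q) \<in> ?R")
      case False
      with that P(1) Q(1) have "(p, q) \<in> M \<times> N" by blast
      with c show ?thesis by (auto simp: matrix_space_def)
    qed (use R in blast)
    have row: "(\<lambda>f. c (p, f)) \<in> V" and col: "(\<lambda>e. c (e, f)) \<in> U" for p f
      using c by (simp_all add: matrix_space_def)
    have "c (p, f) = 0" if "p \<in> P0 \<union> PM" for p f
      using determiningD[OF detV row, of p f] PQ[OF that] by blast
    then have "c (e, f) = 0" for e f
      using determiningD[OF detU col, of f e] by blast
    then show "c z = 0" by (cases z) simp
  qed
  fix z assume "z \<in> ?R"
  then obtain p q where z: "z = (p, q)" "p \<in> P0 \<union> PM" "q \<in> Q0 \<union> QN" "p \<in> P0 \<or> q \<in> Q0"
    by (cases z) auto
  have "\<exists>u\<in>U. u p \<noteq> 0 \<and> (\<forall>r\<in>P0 \<union> PM - {p}. u r = 0) \<and> (p \<in> P0 \<longrightarrow> (\<forall>e\<in>M. u e = 0))"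
  proof (cases "p \<in> P0")
    case True
    with P(3) obtain u where "u \<in> U" "\<forall>e\<in>M. u e = 0" "u p \<noteq> 0" "\<forall>r\<in>P0 - {p}. u r = 0"
      unfolding pivots_def by blast
    with P(1) show ?thesis by blast
  next
    case False
    with P(4) z(2) show ?thesis unfolding pivots_def by blast
  qed
  then obtain u where u: "u \<in> U" "u p \<noteq> 0" "\<forall>r\<in>P0 \<union> PM - {p}. u r = 0" "p \<in> P0 \<Longrightarrow> \<forall>e\<in>M. u e = 0"
    by blast
  have "\<exists>v\<in>V. v q \<noteq> 0 \<and> (\<forall>r\<in>Q0 \<union> QN - {q}. v r = 0) \<and> (q \<in> Q0 \<longrightarrow> (\<forall>f\<in>N. v f = 0))"
  proof (cases "q \<in> Q0")
    case True
    with Q(3) obtain v where "v \<in> V" "\<forall>f\<in>N. v f = 0" "v q \<noteq> 0" "\<forall>r\<in>Q0 - {q}. v r = 0"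
      unfolding pivots_def by blast
    with Q(1) show ?thesis by blast
  next
    case False
    with Q(4) z(3) show ?thesis unfolding pivots_def by blast
  qed
  then obtain v where v: "v \<in> V" "v q \<noteq> 0" "\<forall>r\<in>Q0 \<union> QN - {q}. v r = 0" "q \<in> Q0 \<Longrightarrow> \<forall>f\<in>N. v f = 0"
    by blast
  let ?c = "\<lambda>(e, f). u e * v f"
  have "(\<lambda>e. u e * v f) \<in> U" for f
    using U[OF u(1), of "v f"] by (simp add: mult.commute)
  moreover have "\<forall>w\<in>M \<times> N. ?c w = 0"
    using z(4) u(4) v(4) by auto
  ultimately have "?c \<in> ?X"
    using V[OF v(1)] by (simp add: matrix_space_def)
  moreover have "?c z \<noteq> 0" using z u v by simp
  moreover have "?c w = 0" if "w \<in> ?R - {z}" for w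
  proof -
    obtain r s where w: "w = (r, s)" by (cases w)
    with that z(1) have "r \<in> P0 \<union> PM" "s \<in> Q0 \<union> QN" "r \<noteq> p \<or> s \<noteq> q" by auto
    then have "u r = 0 \<or> v s = 0" using u(3) v(3) by blast
    then show ?thesis using w by auto
  qed
  ultimately show "\<exists>c\<in>?X. c z \<noteq> 0 \<and> (\<forall>w\<in>?R - {z}. c w = 0)"
    by (intro bexI[of _ ?c] conjI ballI)
qed

lemma card_adapted_pivots:
  assumes "finite P0" "finite PM" "P0 \<inter> PM = {}" "finite Q0" "finite QN" "Q0 \<inter> QN = {}"
  shows "int (card ((P0 \<union> PM) \<times> (Q0 \<union> QN) - PM \<times> QN))
       = int (card P0) * int (card (Q0 \<union> QN)) + int (card (P0 \<union> PM)) * int (card Q0)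
         - int (card P0) * int (card Q0)"
proof -
  have "card ((P0 \<union> PM) \<times> (Q0 \<union> QN) - PM \<times> QN)
      = card (P0 \<union> PM) * card (Q0 \<union> QN) - card PM * card QN"
    using assms by (subst card_Diff_subset) (auto simp: card_cartesian_product)
  also have "\<dots> = card P0 * card Q0 + card P0 * card QN + card PM * card Q0"
    using assms by (simp add: card_Un_disjoint algebra_simps)
  finally show ?thesis
    using assms by (simp add: card_Un_disjoint algebra_simps)
qed

lemma pivots_blocks:
  assumes I: "finite I" and P: "\<And>i. i \<in> I \<Longrightarrow> pivots (U i) (P i)"
    and disj: "\<And>i k. i \<in> I \<Longrightarrow> k \<in> I \<Longrightarrow> i \<noteq> k \<Longrightarrow> S i \<inter> S k = {}"
    and supp: "\<And>i u e. i \<in> I \<Longrightarrow> u \<in> U i \<Longrightarrow> e \<notin> S i \<Longrightarrow> u e = 0"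
    and suppV: "\<And>v e. v \<in> V \<Longrightarrow> e \<notin> (\<Union>i\<in>I. S i) \<Longrightarrow> v e = 0"
    and cut: "\<And>i v. i \<in> I \<Longrightarrow> v \<in> V \<Longrightarrow> cut (S i) v \<in> U i"
    and sub: "\<And>i. i \<in> I \<Longrightarrow> U i \<subseteq> V"
  shows "pivots V (\<Union>i\<in>I. P i)" "card (\<Union>i\<in>I. P i) = (\<Sum>i\<in>I. card (P i))"
proof -
  have PS: "P i \<subseteq> S i" if "i \<in> I" for i
    using P[OF that] supp[OF that] unfolding pivots_def by blast
  have finP: "finite (P i)" if "i \<in> I" for i
    using P[OF that] by (simp add: pivots_def)
  show "card (\<Union>i\<in>I. P i) = (\<Sum>i\<in>I. card (P i))"
    using I finP PS disj by (intro card_UN_disjoint) blast+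
  show "pivots V (\<Union>i\<in>I. P i)"
    unfolding pivots_def
  proof (intro conjI ballI)
    show "finite (\<Union>i\<in>I. P i)" using I finP by blast
    show "determining V (\<Union>i\<in>I. P i)"
      unfolding determining_def
    proof (intro ballI impI allI)
      fix v e assume v: "v \<in> V" "\<forall>p\<in>\<Union>i\<in>I. P i. v p = 0"
      have "cut (S i) v e = 0" if "i \<in> I" for i
      proof -
        have "\<forall>p\<in>P i. cut (S i) v p = 0" using v(2) that by (auto simp: cut_def)
        with P[OF that] cut[OF that v(1)] show ?thesis
          unfolding pivots_def determining_def by blast
      qed
      then have "v e = 0" if "e \<in> (\<Union>i\<in>I. S i)"
        using that unfolding cut_def by fastforce
      with suppV[OF v(1)] show "v e = 0" by blast
    qed
    fix p assume "p \<in> (\<Union>i\<in>I. P i)"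
    then obtain i where i: "i \<in> I" "p \<in> P i" by blast
    with P obtain u where u: "u \<in> U i" "u p \<noteq> 0" "\<forall>q\<in>P i - {p}. u q = 0"
      unfolding pivots_def by blast
    have "u q = 0" if q: "q \<in> (\<Union>i\<in>I. P i) - {p}" for q
    proof (cases "q \<in> P i")
      case False
      with q PS disj[OF i(1)] have "q \<notin> S i" by blast
      with supp[OF i(1) u(1)] show ?thesis .
    qed (use u q in blast)
    with u sub[OF i(1)] show "\<exists>u\<in>V. u p \<noteq> 0 \<and> (\<forall>q\<in>(\<Union>i\<in>I. P i) - {p}. u q = 0)" by blast
  qed
qed

section \<open>Wedges of two graphs\<close>

lemma cycle_space_scale: "u \<in> cycle_space G \<Longrightarrow> (\<lambda>e. k * u e) \<in> cycle_space G"
  unfolding cycle_space_def by (simp add: mult.assoc flip: sum_distrib_left)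

lemma cycle_space_outside: "u \<in> cycle_space G \<Longrightarrow> e \<notin> arcs G \<Longrightarrow> u e = 0"
  by (simp add: cycle_space_def)

lemma zero_cycle_space: "(\<lambda>e. 0) \<in> cycle_space G"
  by (simp add: cycle_space_def)

lemma cycle_space_del_vert:
  assumes "finite (arcs H)"
  shows "cycle_space (pre_digraph.del_vert H x) =
     {u \<in> cycle_space H. \<forall>e\<in>{e \<in> arcs H. x \<in> ends H e}. u e = 0}"
proof -
  let ?T = "pre_digraph.del_vert H x"
  have arcs: "arcs ?T = {e \<in> arcs H. x \<notin> ends H e}"
    by (auto simp: pre_digraph.del_vert_def ends_def)
  have "incidence ?T = incidence H"
    by (simp add: fun_eq_iff incidence_def pre_digraph.del_vert_def)
  moreover have "(\<Sum>e\<in>arcs ?T. u e * incidence H w e) = (\<Sum>e\<in>arcs H. u e * incidence H w e)"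
    if "\<forall>e\<in>{e \<in> arcs H. x \<in> ends H e}. u e = 0" for u w
    using assms that arcs by (intro sum.mono_neutral_left) auto
  ultimately show ?thesis
    unfolding cycle_space_def arcs by (auto simp: arcs)
qed

locale wedge =
  fixes H :: "('a, 'b) pre_digraph" and K :: "bool \<Rightarrow> ('a, 'b) pre_digraph" and x :: 'a
  assumes finite_arcs: "finite (arcs H)"
    and arcs_eq: "arcs H = arcs (K True) \<union> arcs (K False)"
    and arcs_disjoint: "arcs (K True) \<inter> arcs (K False) = {}"
    and tail_eq [simp]: "tail (K i) = tail H" and head_eq [simp]: "head (K i) = head H"
    and ends_meet: "e \<in> arcs (K True) \<Longrightarrow> f \<in> arcs (K False) \<Longrightarrow> ends H e \<inter> ends H f \<subseteq> {x}"
begin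

lemma incidence_eq [simp]: "incidence (K i) = incidence H"
  by (simp add: fun_eq_iff incidence_def)

lemma ends_eq [simp]: "ends (K i) = ends H"
  by (simp add: fun_eq_iff ends_def)

lemma finite_arcs_part: "finite (arcs (K i))"
  using finite_arcs arcs_eq by (cases i) auto

lemma arcs_subset: "arcs (K i) \<subseteq> arcs H"
  using arcs_eq by (cases i) auto

lemma arcs_split: "arcs H = arcs (K i) \<union> arcs (K (\<not> i))" "arcs (K i) \<inter> arcs (K (\<not> i)) = {}"
  using arcs_eq arcs_disjoint by (cases i; auto)+

lemma ends_meet': "e \<in> arcs (K i) \<Longrightarrow> f \<in> arcs (K (\<not> i)) \<Longrightarrow> ends H e \<inter> ends H f \<subseteq> {x}"
  using ends_meet by (cases i) (auto simp: Int_commute)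

text \<open>Away from \<open>x\<close> the boundary of a cycle is computed in one part only; at \<open>x\<close> it vanishes
  because the coefficients of a boundary add up to zero.\<close>

lemma cut_cycle_space:
  assumes u: "u \<in> cycle_space H"
  shows "cut (arcs (K i)) u \<in> cycle_space (K i)"
proof -
  let ?b = "\<lambda>i w. \<Sum>e\<in>arcs (K i). u e * incidence H w e"
  have "?b i w + ?b (\<not> i) w = (\<Sum>e\<in>arcs H. u e * incidence H w e)" for w
    unfolding arcs_split(1)[of i]
    by (rule sum.union_disjoint[symmetric]) (use arcs_split(2) finite_arcs_part in auto)
  with u have sum0: "?b i w + ?b (\<not> i) w = 0" for w
    by (simp add: cycle_space_def)
  have away: "?b k w = 0" if "\<forall>e\<in>arcs (K k). w \<notin> ends H e" for w k
    using that by (intro sum.neutral) (auto simp: incidence_def ends_def)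
  have off: "?b i w = 0" if "w \<noteq> x" for w
  proof (cases "\<forall>e\<in>arcs (K i). w \<notin> ends H e")
    case False
    with that ends_meet'[of _ i] have "\<forall>f\<in>arcs (K (\<not> i)). w \<notin> ends H f" by blast
    from away[OF this] sum0[of w] show ?thesis by simp
  qed (rule away)
  let ?W = "insert x (\<Union>e\<in>arcs (K i). ends H e)"
  have W: "finite ?W" using finite_arcs_part by (auto simp: ends_def)
  have "(\<Sum>w\<in>?W. ?b i w) = (\<Sum>e\<in>arcs (K i). u e * (\<Sum>w\<in>?W. incidence H w e))"
    unfolding sum_distrib_left by (rule sum.swap)
  also have "\<dots> = 0"
  proof (rule sum.neutral, rule ballI)
    fix e assume "e \<in> arcs (K i)"
    then have "head H e \<in> ?W" "tail H e \<in> ?W" by (auto simp: ends_def)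
    with W have "(\<Sum>w\<in>?W. incidence H w e) = 0"
      unfolding incidence_def sum_subtractf of_bool_def by (simp only: sum.delta')
    then show "u e * (\<Sum>w\<in>?W. incidence H w e) = 0" by simp
  qed
  also have "(\<Sum>w\<in>?W. ?b i w) = ?b i x + (\<Sum>w\<in>?W - {x}. ?b i w)"
    using W by (intro sum.remove) auto
  also have "(\<Sum>w\<in>?W - {x}. ?b i w) = 0"
    by (intro sum.neutral) (use off in auto)
  finally have "?b i w = 0" for w
    using off by (cases "w = x") auto
  then show ?thesis by (simp add: cycle_space_def cut_def)
qed

lemma cycle_space_part: "cycle_space (K i) \<subseteq> cycle_space H"
proof
  fix u assume u: "u \<in> cycle_space (K i)"
  have "(\<Sum>e\<in>arcs H. u e * incidence H w e) = (\<Sum>e\<in>arcs (K i). u e * incidence H w e)" for w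
    using u by (intro sum.mono_neutral_right finite_arcs arcs_subset) (auto simp: cycle_space_def)
  with u arcs_subset[of i] show "u \<in> cycle_space H"
    by (auto simp: cycle_space_def)
qed

definition star :: "bool \<Rightarrow> 'b set" where
  "star i = {e \<in> arcs (K i). x \<in> ends H e}"

definition block :: "bool \<times> bool \<Rightarrow> ('b \<times> 'b \<Rightarrow> int) set" where
  "block = (\<lambda>(i, k). matrix_space (cycle_space (K i)) (cycle_space (K k))
     (if i = k then meeting (K i) else star i \<times> star k))"

lemma cut_block:
  assumes "c \<in> matrix_space (cycle_space H) (cycle_space H) (meeting H)"
  shows "cut (arcs (K i) \<times> arcs (K k)) c \<in> block (i, k)"
proof -
  let ?c = "cut (arcs (K i) \<times> arcs (K k)) c"
  have "(\<lambda>e. ?c (e, f)) = (if f \<in> arcs (K k) then cut (arcs (K i)) (\<lambda>e. c (e, f)) else (\<lambda>e. 0))" for f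
    by (auto simp: cut_def)
  moreover have "(\<lambda>f. ?c (e, f)) = (if e \<in> arcs (K i) then cut (arcs (K k)) (\<lambda>f. c (e, f)) else (\<lambda>f. 0))" for e
    by (auto simp: cut_def)
  moreover have "?c z = 0" if "z \<in> (if i = k then meeting (K i) else star i \<times> star k)" for z
  proof -
    have "z \<in> meeting H" using that by (auto simp: meeting_def star_def split: if_splits)
    with assms show ?thesis by (simp add: matrix_space_def cut_def)
  qed
  ultimately show ?thesis
    using assms cut_cycle_space zero_cycle_space
    by (auto simp: block_def matrix_space_def)
qed

lemma block_outside: "c \<in> block (i, k) \<Longrightarrow> z \<notin> arcs (K i) \<times> arcs (K k) \<Longrightarrow> c z = 0"
  by (cases z) (auto simp: block_def matrix_space_def dest: cycle_space_outside)

lemma block_subset: "block (i, k) \<subseteq> matrix_space (cycle_space H) (cycle_space H) (meeting H)"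
proof
  fix c assume c: "c \<in> block (i, k)"
  have "c z = 0" if z: "z \<in> meeting H" for z
  proof (cases "z \<in> arcs (K i) \<times> arcs (K k)")
    case True
    then obtain e f where ef: "z = (e, f)" "e \<in> arcs (K i)" "f \<in> arcs (K k)" by blast
    have "z \<in> (if i = k then meeting (K i) else star i \<times> star k)"
    proof (cases "i = k")
      case False
      then have "k = (\<not> i)" by auto
      with ef ends_meet'[of e i f] z show ?thesis by (auto simp: meeting_def star_def)
    qed (use z in \<open>simp add: meeting_def\<close>)
    with c show ?thesis by (auto simp: block_def matrix_space_def)
  qed (rule block_outside[OF c])
  moreover have "(\<lambda>e. c (e, f)) \<in> cycle_space H" for f
    by (rule subsetD[OF cycle_space_part[of i]]) (use c in \<open>simp add: block_def matrix_space_def\<close>)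
  moreover have "(\<lambda>f. c (e, f)) \<in> cycle_space H" for e
    by (rule subsetD[OF cycle_space_part[of k]]) (use c in \<open>simp add: block_def matrix_space_def\<close>)
  ultimately show "c \<in> matrix_space (cycle_space H) (cycle_space H) (meeting H)"
    by (simp add: matrix_space_def)
qed

lemma matrix_space_outside:
  assumes "c \<in> matrix_space (cycle_space G) (cycle_space G) Z" "z \<notin> arcs G \<times> arcs G"
  shows "c z = 0"
  using assms by (cases z) (auto simp: matrix_space_def dest: cycle_space_outside)

theorem betti_disc_config2_wedge:
  "int (betti 2 (disc_config2 H)) =
     int (betti 2 (disc_config2 (K True))) + int (betti 2 (disc_config2 (K False)))
     + 2 * (int (betti 1 (graph_complex (pre_digraph.del_vert (K True) x))) * int (betti 1 (graph_complex (K False)))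
            + int (betti 1 (graph_complex (K True))) * int (betti 1 (graph_complex (pre_digraph.del_vert (K False) x)))
            - int (betti 1 (graph_complex (pre_digraph.del_vert (K True) x)))
              * int (betti 1 (graph_complex (pre_digraph.del_vert (K False) x))))"
proof -
  let ?T = "\<lambda>i. pre_digraph.del_vert (K i) x"
  have T: "cycle_space (?T i) = {u \<in> cycle_space (K i). \<forall>e\<in>star i. u e = 0}" for i
    using cycle_space_del_vert[OF finite_arcs_part] by (simp add: star_def)
  have finT: "finite (arcs (?T i))" for i
    using finite_arcs_part[of i] by (simp add: pre_digraph.del_vert_def)
  have finstar: "finite (star i)" for i
    using finite_arcs_part[of i] by (simp add: star_def)
  have "\<exists>P0 PN. PN \<subseteq> star i \<and> P0 \<inter> PN = {} \<and> pivots (cycle_space (?T i)) P0 \<and>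
      pivots (cycle_space (K i)) (P0 \<union> PN)" for i
    unfolding T by (rule adapted_pivots[OF finite_arcs_part[of i] finstar]) (rule cycle_space_outside)
  then obtain P0 PN where P: "PN i \<subseteq> star i" "P0 i \<inter> PN i = {}" "pivots (cycle_space (?T i)) (P0 i)"
    "pivots (cycle_space (K i)) (P0 i \<union> PN i)" for i by metis
  have fin: "finite (P0 i)" "finite (PN i)" for i
    using P(4)[of i] by (auto simp: pivots_def)
  have b: "betti 1 (graph_complex (?T i)) = card (P0 i)" "betti 1 (graph_complex (K i)) = card (P0 i \<union> PN i)" for i
    using P betti_graph_complex finT finite_arcs_part by blast+
  have "\<exists>D. pivots (block (i, i)) D" for i
    by (rule pivots_exists[of "arcs (K i) \<times> arcs (K i)"])
      (use finite_arcs_part block_outside in auto)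
  then obtain D where D: "pivots (block (i, i)) (D i)" for i by metis
  define R where "R = (\<lambda>(i, k). if i = k then D i else (P0 i \<union> PN i) \<times> (P0 k \<union> PN k) - PN i \<times> PN k)"
  have R: "pivots (block j) (R j)" for j
  proof (cases j)
    case (Pair i k)
    show ?thesis
    proof (cases "i = k")
      case False
      have "pivots (matrix_space (cycle_space (K i)) (cycle_space (K k)) (star i \<times> star k))
          ((P0 i \<union> PN i) \<times> (P0 k \<union> PN k) - PN i \<times> PN k)"
        using P T by (intro pivots_matrix_space cycle_space_scale) auto
      with False Pair show ?thesis by (simp add: block_def R_def)
    qed (use D Pair in \<open>simp add: R_def\<close>)
  qed
  let ?V = "matrix_space (cycle_space H) (cycle_space H) (meeting H)"
  let ?S = "\<lambda>(i, k). arcs (K i) \<times> arcs (K k)"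
  have "arcs (K i) \<inter> arcs (K k) = {}" if "i \<noteq> k" for i k
    using that arcs_disjoint by (cases i; cases k) auto
  then have S: "?S j \<inter> ?S j' = {}" if "j \<noteq> j'" for j j'
    using that by (cases j; cases j') auto
  have US: "(\<Union>j. ?S j) = arcs H \<times> arcs H"
    unfolding UNIV_Times_UNIV[symmetric] UNIV_bool arcs_eq by auto
  have supp: "c z = 0" if "c \<in> block j" "z \<notin> ?S j" for c j z
    using that block_outside by (cases j) auto
  have suppV: "c z = 0" if "c \<in> ?V" "z \<notin> (\<Union>j\<in>UNIV. ?S j)" for c z
    using matrix_space_outside[OF that(1)] that(2) unfolding US .
  have cutV: "cut (?S j) c \<in> block j" if "c \<in> ?V" for j c
    using cut_block[OF that] by (cases j) simp
  have sub: "block j \<subseteq> ?V" for j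
    using block_subset by (cases j) simp
  have "pivots ?V (\<Union>j\<in>UNIV. R j)"
    by (rule pivots_blocks(1)[where U = block and S = ?S and V = ?V and I = UNIV];
        (rule finite R sub | erule S cutV | erule (1) supp suppV))
  moreover have "card (\<Union>j\<in>UNIV. R j) = (\<Sum>j\<in>UNIV. card (R j))"
    by (rule pivots_blocks(2)[where U = block and S = ?S and V = ?V and I = UNIV];
        (rule finite R sub | erule S cutV | erule (1) supp suppV))
  ultimately have "betti 2 (disc_config2 H) = (\<Sum>j\<in>UNIV. card (R j))"
    using betti_disc_config2[OF finite_arcs] by simp
  also have "\<dots> = card (R (True, True)) + card (R (False, False)) + card (R (True, False)) + card (R (False, True))"
    unfolding UNIV_Times_UNIV[symmetric] UNIV_bool by simp
  finally have "int (betti 2 (disc_config2 H)) = int (card (D True)) + int (card (D False))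
      + int (card (R (True, False))) + int (card (R (False, True)))"
    by (simp add: R_def)
  moreover have "betti 2 (disc_config2 (K i)) = card (D i)" for i
    using betti_disc_config2[OF finite_arcs_part, of i] D[of i] by (simp add: block_def)
  moreover have "int (card (R (i, k))) = int (card (P0 i)) * int (card (P0 k \<union> PN k))
      + int (card (P0 i \<union> PN i)) * int (card (P0 k)) - int (card (P0 i)) * int (card (P0 k))"
    if "i \<noteq> k" for i k
    using that card_adapted_pivots[OF fin P(2) fin P(2)] by (simp add: R_def)
  ultimately show ?thesis unfolding b by (simp add: algebra_simps)
qed

end

section \<open>Splitting at the cut vertex\<close>

lemma component_verts_cover:
  assumes "wf_digraph H" "u \<in> verts H"
  shows "\<exists>C\<in>component_verts H. u \<in> C"
proof -
  interpret M: wf_digraph "with_proj (mk_symmetric H)"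
    using wf_digraph.wellformed_mk_symmetric[OF assms(1)] by (simp add: wf_digraph_wp_iff)
  have "u \<in> verts (with_proj (mk_symmetric H))" using assms(2) by simp
  then show ?thesis
    unfolding component_verts_def using M.scc_of_in_sccs_verts M.in_scc_of_self by blast
qed

lemma component_verts_disjoint:
  assumes "wf_digraph H" "C \<in> component_verts H" "D \<in> component_verts H" "C \<noteq> D"
  shows "C \<inter> D = {}"
proof -
  interpret M: wf_digraph "with_proj (mk_symmetric H)"
    using wf_digraph.wellformed_mk_symmetric[OF assms(1)] by (simp add: wf_digraph_wp_iff)
  show ?thesis
    using M.sccs_verts_disjoint assms(2-) by (simp add: component_verts_def)
qed

lemma component_verts_arc:
  assumes "wf_digraph H" "e \<in> arcs H" "C \<in> component_verts H" "tail H e \<in> C \<or> head H e \<in> C"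
  shows "tail H e \<in> C" "head H e \<in> C"
proof -
  let ?M = "with_proj (mk_symmetric H)"
  interpret M: wf_digraph ?M
    using wf_digraph.wellformed_mk_symmetric[OF assms(1)] by (simp add: wf_digraph_wp_iff)
  have "(tail H e, head H e) \<in> parcs (mk_symmetric H)" "(head H e, tail H e) \<in> parcs (mk_symmetric H)"
    using assms(2) by (auto simp: mk_symmetric_def)
  then have "tail H e \<rightarrow>\<^bsub>?M\<^esub> head H e" "head H e \<rightarrow>\<^bsub>?M\<^esub> tail H e"
    by (force simp: arcs_ends_def arc_to_ends_def)+
  then have "tail H e \<rightarrow>\<^sup>*\<^bsub>?M\<^esub> head H e" "head H e \<rightarrow>\<^sup>*\<^bsub>?M\<^esub> tail H e"
    by (auto intro: M.reachable_adjI)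
  with assms(3,4) show "tail H e \<in> C" "head H e \<in> C"
    unfolding component_verts_def M.in_sccs_verts_conv_reachable by blast+
qed

lemma one_connected_two_arcs:
  assumes G: "simple_graph G" and oc: "one_connected_two G v G1 G2"
  shows "arcs G = arcs G1 \<union> arcs G2" "arcs G1 \<inter> arcs G2 = {}"
    "tail G1 = tail G" "head G1 = head G" "tail G2 = tail G" "head G2 = head G"
    "\<And>e f. e \<in> arcs G1 \<Longrightarrow> f \<in> arcs G2 \<Longrightarrow> ends G e \<inter> ends G f \<subseteq> {v}"
proof -
  interpret fin_digraph G using G by (simp add: simple_graph_def)
  interpret loopfree_digraph G using G by (simp add: simple_graph_def)
  let ?H = "del_vert v"
  have wf: "wf_digraph ?H" by (rule wf_digraph_del_vert)
  obtain C1 C2 where C: "C1 \<noteq> C2" "component_verts ?H = {C1, C2}"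
    and G12: "G1 = G \<restriction> insert v C1" "G2 = G \<restriction> insert v C2"
    using oc by (auto simp: one_connected_two_def)
  have disj: "C1 \<inter> C2 = {}"
    using component_verts_disjoint[OF wf] C by auto
  have cover: "u \<in> C1 \<union> C2" if "u \<in> verts G" "u \<noteq> v" for u
    using component_verts_cover[OF wf, of u] that C(2) by (auto simp: verts_del_vert)
  have arc: "tail G e \<in> D \<and> head G e \<in> D"
    if "e \<in> arcs G" "tail G e \<noteq> v" "head G e \<noteq> v" "D \<in> {C1, C2}" "tail G e \<in> D \<or> head G e \<in> D" for e D
    using component_verts_arc[OF wf, of e D] that C(2) by (auto simp: del_vert_simps)
  have "e \<in> arcs G1 \<union> arcs G2" if e: "e \<in> arcs G" for e
  proof (cases "tail G e = v \<or> head G e = v")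
    case True
    with e no_loops[OF e] cover[of "tail G e"] cover[of "head G e"] show ?thesis
      by (auto simp: G12)
  next
    case False
    with e cover[of "tail G e"] arc[of e C1] arc[of e C2] show ?thesis
      by (auto simp: G12)
  qed
  then show "arcs G = arcs G1 \<union> arcs G2" by (auto simp: G12)
  show "arcs G1 \<inter> arcs G2 = {}"
  proof (rule equals0I)
    fix e assume "e \<in> arcs G1 \<inter> arcs G2"
    then have "tail G e = v" "head G e = v" "e \<in> arcs G" using disj by (auto simp: G12)
    with no_loops[of e] show False by simp
  qed
  show "ends G e \<inter> ends G f \<subseteq> {v}" if "e \<in> arcs G1" "f \<in> arcs G2" for e f
    using that disj by (auto simp: G12 ends_def)
qed (use oc in \<open>auto simp: one_connected_two_def\<close>)

lemma wedge_subdivide_at: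
  fixes G G1 G2 :: "('a, 'b) pre_digraph"
  assumes fin: "finite (arcs G)"
    and arcs: "arcs G = arcs G1 \<union> arcs G2" "arcs G1 \<inter> arcs G2 = {}"
    and eq: "tail G1 = tail G" "head G1 = head G" "tail G2 = tail G" "head G2 = head G"
    and meet: "\<And>e f. e \<in> arcs G1 \<Longrightarrow> f \<in> arcs G2 \<Longrightarrow> ends G e \<inter> ends G f \<subseteq> {v}"
  shows "wedge (subdivide_at G v) (\<lambda>i. subdivide_at (if i then G1 else G2) v) (Old v)"
proof
  have inc: "incident_arcs G1 v = arcs G1 \<inter> incident_arcs G v"
    "incident_arcs G2 v = arcs G2 \<inter> incident_arcs G v"
    using arcs(1) eq by (auto simp: incident_arcs_def)
  have "incident_arcs G v \<subseteq> arcs G" by (auto simp: incident_arcs_def)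
  with fin show "finite (arcs (subdivide_at G v))"
    by (auto simp: subdivide_at_def intro: finite_subset)
  show "arcs (subdivide_at G v) =
      arcs (subdivide_at (if True then G1 else G2) v) \<union> arcs (subdivide_at (if False then G1 else G2) v)"
    using \<open>incident_arcs G v \<subseteq> arcs G\<close> unfolding subdivide_at_def by (auto simp: inc arcs(1))
  show "arcs (subdivide_at (if True then G1 else G2) v) \<inter> arcs (subdivide_at (if False then G1 else G2) v) = {}"
    using arcs(2) by (auto simp: subdivide_at_def inc)
  have tl: "sub_tail K = sub_tail G" if "tail K = tail G" for K :: "('a, 'b) pre_digraph"
  proof
    show "sub_tail K s = sub_tail G s" for s using that by (cases s) auto
  qed
  have hd: "sub_head K = sub_head G" if "head K = head G" for K :: "('a, 'b) pre_digraph"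
  proof
    show "sub_head K s = sub_head G s" for s using that by (cases s) auto
  qed
  show "tail (subdivide_at (if i then G1 else G2) v) = tail (subdivide_at G v)"
    "head (subdivide_at (if i then G1 else G2) v) = head (subdivide_at G v)" for i
    by (auto simp: subdivide_at_def tl[OF eq(1)] tl[OF eq(3)] hd[OF eq(2)] hd[OF eq(4)])
  have ends_sub: "ends (subdivide_at G v) s \<subseteq> Old ` ends G e \<union> {Mid e}"
    if "s \<in> {Whole e, FirstHalf e, SecondHalf e}" for s e
    using that by (auto simp: ends_def subdivide_at_def)
  fix s t
  assume "s \<in> arcs (subdivide_at (if True then G1 else G2) v)"
    and "t \<in> arcs (subdivide_at (if False then G1 else G2) v)"
  then obtain e f where ef: "e \<in> arcs G1" "s \<in> {Whole e, FirstHalf e, SecondHalf e}"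
      "f \<in> arcs G2" "t \<in> {Whole f, FirstHalf f, SecondHalf f}"
    by (auto simp: subdivide_at_def inc)
  from ef arcs(2) have "e \<noteq> f" by blast
  with ends_sub[OF ef(2)] ends_sub[OF ef(4)] meet[OF ef(1,3)]
  show "ends (subdivide_at G v) s \<inter> ends (subdivide_at G v) t \<subseteq> {Old v}" by blast
qed

theorem mainTheorem3:
  fixes G G1 G2 :: "('a, 'b) pre_digraph" and v :: 'a
    and \<Gamma> \<Gamma>\<^sub>1 \<Gamma>\<^sub>2 T\<^sub>1 T\<^sub>2 :: "(('a, 'b) sub_vert, 'b sub_arc) pre_digraph"
  assumes "simple_graph G"
    and "one_connected_two G v G1 G2"
    and "\<Gamma> = subdivide_at G v"
    and "\<Gamma>\<^sub>1 = subdivide_at G1 v"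
    and "\<Gamma>\<^sub>2 = subdivide_at G2 v"
    and "T\<^sub>1 = pre_digraph.del_vert \<Gamma>\<^sub>1 (Old v)"
    and "T\<^sub>2 = pre_digraph.del_vert \<Gamma>\<^sub>2 (Old v)"
  shows "int (betti 2 (disc_config2 \<Gamma>)) =
           int (betti 2 (disc_config2 \<Gamma>\<^sub>1)) + int (betti 2 (disc_config2 \<Gamma>\<^sub>2))
           + 2 * (int (betti 1 (graph_complex T\<^sub>1)) * int (betti 1 (graph_complex \<Gamma>\<^sub>2))
                  + int (betti 1 (graph_complex \<Gamma>\<^sub>1)) * int (betti 1 (graph_complex T\<^sub>2))
                  - int (betti 1 (graph_complex T\<^sub>1)) * int (betti 1 (graph_complex T\<^sub>2)))"
proof -
  have "finite (arcs G)"
    using assms(1) by (auto simp: simple_graph_def fin_digraph_def fin_digraph_axioms_def)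
  note wedge_subdivide_at[OF this one_connected_two_arcs[OF assms(1,2)]]
  from wedge.betti_disc_config2_wedge[OF this] show ?thesis
    by (simp only: assms(3-7) if_True if_False)
qed

end
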